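(* Let $(S,\bullet)$ be a right adequate partial semigroup and let $p\in\delta_R S$. The following are equivalent: (a) $p\in K(\beta S)$; (b) for every $A\in p$, the set $\{s\in S:s^{-1}A\in p\}$ is partially syndetic; (c) for every $q\in\overline{L(p)}$, $p\in(\beta S\bullet q)\bullet p$.
   Context: A partial semigroup is a nonempty set $S$ with a partially defined operation $\bullet$ such that $(x\bullet y)\bullet z=x\bullet(y\bullet z)$ in the sense that if either side is defined so is the other and they are equal. $R(x)=\{s:x\bullet s\text{ defined}\}$, $R(H)=\bigcap_{s\in H}R(s)$ for finite nonempty $H$; $S$ is right adequate if $R(H)\neq\emptyset$ for all such $H$. $\beta S$: ultrafilters on $S$, $\overline{A}=\{p:A\in p\}$; $\delta_RS=\bigcap_{H}\overline{R(H)}$ over finite nonempty $H\subseteq S$. $s^{-1}A=\{t\in R(s):s\bullet t\in A\}$. For $p\in\beta S$, $L(p)=\{s\in S:R(s)\in p\}$; for $p,q\in\beta S$ with $L(q)\in p$, $p\bullet q=\{A:\{s:s^{-1}A\in q\}\in p\}$; $(\beta S,\bullet)$ is a partial semigroup, and $\beta S\bullet q$ denotes $\{r\bullet q: r\in\beta S,\ r\bullet q\text{ defined}\}$ (similarly for products of sets). $K(\beta S)$ is the smallest two-sided ideal of $\beta S$ (an ideal being a nonempty set $I$ with $y\bullet x\in I$ and $x\bullet y\in I$ whenever $x\in I$ and the product is defined). $A\subseteq S$ is partially syndetic if for every $r\in\beta S$ there is finite nonempty $H\subseteq L(r)$ with $R(H)\subseteq\bigcup_{t\in H}t^{-1}A$.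 *)

theory Defs
  imports Main
begin

text \<open>
  A partial operation is a curried function into an option type, \<open>None\<close> meaning
  ``undefined''. With \<^const>\<open>Option.bind\<close>, associativity is the strong (Kleene) equality:
  if one side is defined then so is the other and they agree.
\<close>

definition partial_semigroup :: "'a set \<Rightarrow> ('a \<Rightarrow> 'a \<Rightarrow> 'a option) \<Rightarrow> bool" where
  "partial_semigroup S f \<longleftrightarrow>
     S \<noteq> {} \<and>
     (\<forall>x\<in>S. \<forall>y\<in>S. \<forall>z. f x y = Some z \<longrightarrow> z \<in> S) \<and>
     (\<forall>x\<in>S. \<forall>y\<in>S. \<forall>z\<in>S.
        Option.bind (f x y) (\<lambda>u. f u z) = Option.bind (f y z) (\<lambda>v. f x v))"

definition set_mult :: "('a \<Rightarrow> 'a \<Rightarrow> 'a option) \<Rightarrow> 'a set \<Rightarrow> 'a set \<Rightarrow> 'a set" where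
  "set_mult f A B = {z. \<exists>x\<in>A. \<exists>y\<in>B. f x y = Some z}"

definition two_sided_ideal :: "'a set \<Rightarrow> ('a \<Rightarrow> 'a \<Rightarrow> 'a option) \<Rightarrow> 'a set \<Rightarrow> bool" where
  "two_sided_ideal S f I \<longleftrightarrow>
     I \<noteq> {} \<and> I \<subseteq> S \<and>
     (\<forall>x\<in>I. \<forall>y\<in>S. \<forall>z. (f y x = Some z \<longrightarrow> z \<in> I) \<and> (f x y = Some z \<longrightarrow> z \<in> I))"

text \<open>
  The intersection of all ideals is the smallest ideal whenever a smallest ideal exists,
  and it is empty exactly when there is none (see the two lemmas below).
\<close>

definition smallest_ideal :: "'a set \<Rightarrow> ('a \<Rightarrow> 'a \<Rightarrow> 'a option) \<Rightarrow> 'a set" where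
  "smallest_ideal S f = \<Inter>{I. two_sided_ideal S f I}"

lemma smallest_ideal_eqI:
  assumes "two_sided_ideal S f I" and "\<And>J. two_sided_ideal S f J \<Longrightarrow> I \<subseteq> J"
  shows "smallest_ideal S f = I"
  using assms unfolding smallest_ideal_def by blast

lemma smallest_ideal_is_ideal:
  assumes "partial_semigroup S f" and "smallest_ideal S f \<noteq> {}"
  shows "two_sided_ideal S f (smallest_ideal S f)"
proof -
  have "two_sided_ideal S f S"
    using assms(1) unfolding partial_semigroup_def two_sided_ideal_def by blast
  then have "smallest_ideal S f \<subseteq> S"
    unfolding smallest_ideal_def by blast
  moreover have "z \<in> smallest_ideal S f"
    if x: "x \<in> smallest_ideal S f" and y: "y \<in> S" and z: "f y x = Some z \<or> f x y = Some z"
    for x y z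
    unfolding smallest_ideal_def
  proof (rule InterI)
    fix I assume "I \<in> {I. two_sided_ideal S f I}"
    then have I: "two_sided_ideal S f I" by simp
    with x have "x \<in> I" unfolding smallest_ideal_def by blast
    with I y z show "z \<in> I" unfolding two_sided_ideal_def by blast
  qed
  ultimately show ?thesis
    using assms(2) unfolding two_sided_ideal_def by blast
qed

definition Rset :: "'a set \<Rightarrow> ('a \<Rightarrow> 'a \<Rightarrow> 'a option) \<Rightarrow> 'a \<Rightarrow> 'a set" where
  "Rset S f x = {s \<in> S. f x s \<noteq> None}"

definition Rfin :: "'a set \<Rightarrow> ('a \<Rightarrow> 'a \<Rightarrow> 'a option) \<Rightarrow> 'a set \<Rightarrow> 'a set" where
  "Rfin S f H = (\<Inter>s\<in>H. Rset S f s)"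

definition right_adequate :: "'a set \<Rightarrow> ('a \<Rightarrow> 'a \<Rightarrow> 'a option) \<Rightarrow> bool" where
  "right_adequate S f \<longleftrightarrow> (\<forall>H. finite H \<and> H \<noteq> {} \<and> H \<subseteq> S \<longrightarrow> Rfin S f H \<noteq> {})"

definition left_quot :: "'a set \<Rightarrow> ('a \<Rightarrow> 'a \<Rightarrow> 'a option) \<Rightarrow> 'a \<Rightarrow> 'a set \<Rightarrow> 'a set" where
  "left_quot S f s A = {t \<in> Rset S f s. the (f s t) \<in> A}"

definition ultrafilter_on :: "'a set \<Rightarrow> 'a set set \<Rightarrow> bool" where
  "ultrafilter_on S p \<longleftrightarrow>
     p \<subseteq> Pow S \<and> S \<in> p \<and> {} \<notin> p \<and>
     (\<forall>A\<in>p. \<forall>B\<in>p. A \<inter> B \<in> p) \<and>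
     (\<forall>A\<in>p. \<forall>B. A \<subseteq> B \<and> B \<subseteq> S \<longrightarrow> B \<in> p) \<and>
     (\<forall>A. A \<subseteq> S \<longrightarrow> A \<in> p \<or> S - A \<in> p)"

definition beta :: "'a set \<Rightarrow> 'a set set set" where
  "beta S = {p. ultrafilter_on S p}"

definition beta_cl :: "'a set \<Rightarrow> 'a set \<Rightarrow> 'a set set set" where
  "beta_cl S A = {p \<in> beta S. A \<in> p}"

definition delta_R :: "'a set \<Rightarrow> ('a \<Rightarrow> 'a \<Rightarrow> 'a option) \<Rightarrow> 'a set set set" where
  "delta_R S f = (\<Inter>H\<in>{H. finite H \<and> H \<noteq> {} \<and> H \<subseteq> S}. beta_cl S (Rfin S f H))"

definition Lset :: "'a set \<Rightarrow> ('a \<Rightarrow> 'a \<Rightarrow> 'a option) \<Rightarrow> 'a set set \<Rightarrow> 'a set" where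
  "Lset S f p = {s \<in> S. Rset S f s \<in> p}"

definition beta_mult ::
  "'a set \<Rightarrow> ('a \<Rightarrow> 'a \<Rightarrow> 'a option) \<Rightarrow> 'a set set \<Rightarrow> 'a set set \<Rightarrow> 'a set set option" where
  "beta_mult S f p q =
     (if Lset S f q \<in> p
      then Some {A. A \<subseteq> S \<and> {s \<in> S. left_quot S f s A \<in> q} \<in> p}
      else None)"

definition partially_syndetic :: "'a set \<Rightarrow> ('a \<Rightarrow> 'a \<Rightarrow> 'a option) \<Rightarrow> 'a set \<Rightarrow> bool" where
  "partially_syndetic S f A \<longleftrightarrow>
     (\<forall>r\<in>beta S. \<exists>H. finite H \<and> H \<noteq> {} \<and> H \<subseteq> Lset S f r \<and>
        Rfin S f H \<subseteq> (\<Union>t\<in>H. left_quot S f t A))"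

end

theory Submission
  imports Defs
begin

text \<open>
  Extend the product of \<open>\<beta>S\<close> to a total operation by giving undefined products the value \<open>\<emptyset>\<close>:
  the defining formula does this by itself, and the result is a semigroup with zero.

  (b) \<open>\<Longrightarrow>\<close> (c): apply syndeticity of \<open>B\<^sub>A = {s. s\<inverse>A \<in> p}\<close> at the point \<open>q\<close>. The sets
  \<open>{t. t\<inverse>B\<^sub>A \<in> q}\<close>, \<open>A \<in> p\<close>, have the finite intersection property, and any ultrafilter \<open>r\<close>
  containing them satisfies \<open>r q p = p\<close>.

  (c) \<open>\<Longrightarrow>\<close> (b): write \<open>p = w r p\<close>. If \<open>B\<^sub>A\<close> is not syndetic at \<open>r\<close>, there is \<open>q\<close> containing
  \<open>R(t) - t\<inverse>B\<^sub>A\<close> for all \<open>t \<in> L(r)\<close>. As \<open>w r p \<in> \<delta>\<^sub>R S\<close>, we have \<open>L(r) \<in> s w\<close> for every \<open>s\<close>, so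
  writing \<open>p = z (w q) p\<close> gives \<open>L(r) \<in> z w\<close> and hence some \<open>t \<in> L(r)\<close> with \<open>t\<inverse>B\<^sub>A \<in> q\<close>.

  (c) \<open>\<Longrightarrow>\<close> (a): every ideal contains some \<open>q\<close>, hence \<open>(r q) p = p\<close>.

  (a) \<open>\<Longrightarrow>\<close> (c): if \<open>u y \<in> \<delta>\<^sub>R S\<close> then \<open>u \<in> \<delta>\<^sub>R S\<close>. Since \<open>p\<close> lies in the ideal generated by \<open>q\<close>, some
  \<open>u = x q\<close> is in \<open>\<delta>\<^sub>R S\<close>. Since \<open>p\<close> also lies in the ideal generated by a minimal closed left ideal
  \<open>M\<close> of \<open>\<delta>\<^sub>R S\<close>, it is \<open>m\<close> or \<open>m y\<close> with \<open>m \<in> M\<close>, and \<open>z u m = m\<close> for some \<open>z\<close> by minimality.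
\<close>

section \<open>Ultrafilters\<close>

text \<open>Intersecting with \<open>S\<close> gives the empty subfamily the value \<open>S\<close>
  instead of \<open>UNIV\<close>; in particular the property forces \<open>S\<close> to be
  nonempty.\<close>

definition fip_on :: "'a set \<Rightarrow> 'a set set \<Rightarrow> bool" where
  "fip_on S F \<longleftrightarrow> F \<subseteq> Pow S \<and> (\<forall>X. finite X \<and> X \<subseteq> F \<longrightarrow> S \<inter> \<Inter>X \<noteq> {})"

text \<open>A finite subfamily of the union already lies in one member of the chain. This supplies
  the upper bounds in both Zorn arguments below.\<close>

lemma fip_on_Union_chain:
  assumes "\<And>F. F \<in> C \<Longrightarrow> fip_on S F" and "subset.chain \<A> C" and "C \<noteq> {}"
  shows "fip_on S (\<Union>C)"
  unfolding fip_on_def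
proof (intro conjI allI impI)
  show "\<Union>C \<subseteq> Pow S" using assms(1) unfolding fip_on_def by blast
  fix X assume "finite X \<and> X \<subseteq> \<Union>C"
  then obtain F where "F \<in> C" "X \<subseteq> F"
    using finite_subset_Union_chain[of X C \<A>] assms(2,3) by blast
  then show "S \<inter> \<Inter>X \<noteq> {}"
    using assms(1) \<open>finite X \<and> X \<subseteq> \<Union>C\<close> unfolding fip_on_def by blast
qed

text \<open>A maximal family with the finite intersection property is an ultrafilter, because it
  absorbs every subset of \<open>S\<close> that meets all its finite intersections.\<close>

lemma fip_on_extends_to_ultrafilter:
  assumes "fip_on S F"
  obtains p where "p \<in> beta S" and "F \<subseteq> p"
proof -
  define \<A> where "\<A> = {G. fip_on S G \<and> F \<subseteq> G}"
  have "\<exists>M\<in>\<A>. \<forall>X\<in>\<A>. M \<subseteq> X \<longrightarrow> X = M"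
  proof (rule subset_Zorn)
    fix C assume C: "subset.chain \<A> C"
    show "\<exists>U\<in>\<A>. \<forall>X\<in>C. X \<subseteq> U"
    proof (cases "C = {}")
      case True
      then show ?thesis using assms unfolding \<A>_def by blast
    next
      case False
      have "C \<subseteq> \<A>" using C unfolding subset.chain_def by blast
      then have "\<Union>C \<in> \<A>"
        using fip_on_Union_chain[OF _ C False] False unfolding \<A>_def by blast
      then show ?thesis by blast
    qed
  qed
  then obtain p where "p \<in> \<A>" and maximal: "\<forall>G\<in>\<A>. p \<subseteq> G \<longrightarrow> G = p" ..
  then have p: "fip_on S p" "F \<subseteq> p" unfolding \<A>_def by simp_all
  have max: "G = p" if "fip_on S G" "p \<subseteq> G" for G
    using maximal that subset_trans[OF p(2) that(2)] unfolding \<A>_def by simp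
  have sub: "p \<subseteq> Pow S" and fip: "\<And>X. finite X \<Longrightarrow> X \<subseteq> p \<Longrightarrow> S \<inter> \<Inter>X \<noteq> {}"
    using p(1) unfolding fip_on_def by blast+
  have memI: "A \<in> p" if A: "A \<subseteq> S" and "\<And>X. finite X \<Longrightarrow> X \<subseteq> p \<Longrightarrow> S \<inter> A \<inter> \<Inter>X \<noteq> {}" for A
  proof -
    have "fip_on S (insert A p)"
      unfolding fip_on_def
    proof (intro conjI allI impI)
      show "insert A p \<subseteq> Pow S" using A sub by blast
      fix X assume X: "finite X \<and> X \<subseteq> insert A p"
      then have "S \<inter> A \<inter> \<Inter>(X - {A}) \<noteq> {}" using that(2)[of "X - {A}"] by blast
      then show "S \<inter> \<Inter>X \<noteq> {}" by blast
    qed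
    then show ?thesis using max[of "insert A p"] by blast
  qed
  \<comment> \<open>With \<open>Y\<close> empty, a singleton or a pair, this yields
    \<open>S \<in> p\<close>, upward closure and closure under intersection.\<close>
  have up: "B \<in> p" if "finite Y" "Y \<subseteq> p" "S \<inter> \<Inter>Y \<subseteq> B" "B \<subseteq> S" for Y B
  proof (rule memI[OF that(4)])
    fix X assume "finite X" "X \<subseteq> p"
    then have "S \<inter> \<Inter>(X \<union> Y) \<noteq> {}" using fip[of "X \<union> Y"] that by blast
    then show "S \<inter> B \<inter> \<Inter>X \<noteq> {}" using that(3) by blast
  qed
  have "ultrafilter_on S p"
    unfolding ultrafilter_on_def
  proof (intro conjI ballI allI impI)
    show "p \<subseteq> Pow S" by (rule sub)
    show "S \<in> p" using up[of "{}"] by blast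
    show "{} \<notin> p" using fip[of "{{}}"] by blast
    show "A \<inter> B \<in> p" if "A \<in> p" "B \<in> p" for A B
      using up[of "{A, B}" "A \<inter> B"] that sub by auto
    show "B \<in> p" if "A \<in> p" "A \<subseteq> B \<and> B \<subseteq> S" for A B
      using up[of "{A}" B] that by auto
    show "A \<in> p \<or> S - A \<in> p" if "A \<subseteq> S" for A
    proof (rule disjCI)
      assume "S - A \<notin> p"
      show "A \<in> p"
      proof (rule memI[OF that])
        fix X assume "finite X" "X \<subseteq> p"
        \<comment> \<open>A finite intersection inside \<open>S - A\<close> would put
          \<open>S - A\<close> into \<open>p\<close> by \<open>up\<close>.\<close>
        then have "\<not> S \<inter> \<Inter>X \<subseteq> S - A" using up[of X "S - A"] \<open>S - A \<notin> p\<close> by blast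
        then show "S \<inter> A \<inter> \<Inter>X \<noteq> {}" by blast
      qed
    qed
  qed
  then show thesis using that p(2) unfolding beta_def by blast
qed

context
  fixes S :: "'a set" and p :: "'a set set"
  assumes p: "p \<in> beta S"
begin

lemma beta_carrier: "S \<in> p" and beta_empty: "{} \<notin> p"
  using p unfolding beta_def ultrafilter_on_def by simp_all

lemma beta_sub:
  assumes "A \<in> p"
  shows "A \<subseteq> S"
proof -
  have "p \<subseteq> Pow S" using p unfolding beta_def ultrafilter_on_def by simp
  then show ?thesis using assms by auto
qed

lemma beta_Int: "A \<in> p \<Longrightarrow> B \<in> p \<Longrightarrow> A \<inter> B \<in> p"
  using p unfolding beta_def ultrafilter_on_def by simp

lemma beta_up:
  assumes "A \<in> p" and "A \<subseteq> B" and "B \<subseteq> S"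
  shows "B \<in> p"
proof -
  have "\<forall>A\<in>p. \<forall>B. A \<subseteq> B \<and> B \<subseteq> S \<longrightarrow> B \<in> p"
    using p unfolding beta_def ultrafilter_on_def by simp
  then show ?thesis using assms by simp
qed

lemma beta_Diff_iff:
  assumes "A \<subseteq> S"
  shows "S - A \<in> p \<longleftrightarrow> A \<notin> p"
proof -
  have "A \<in> p \<or> S - A \<in> p" using p assms unfolding beta_def ultrafilter_on_def by simp
  moreover have "\<not> (A \<in> p \<and> S - A \<in> p)"
    using beta_Int[of A "S - A"] beta_empty by auto
  ultimately show ?thesis by blast
qed

lemma beta_Inter: "finite X \<Longrightarrow> X \<subseteq> p \<Longrightarrow> S \<inter> \<Inter>X \<in> p"
proof (induction X rule: finite_induct)
  case empty
  then show ?case using beta_carrier by simp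
next
  case (insert A X)
  then have "A \<inter> (S \<inter> \<Inter>X) \<in> p" using beta_Int by blast
  then show ?case by (simp add: Int_left_commute)
qed

lemma fip_on_subset_beta: "F \<subseteq> p \<Longrightarrow> fip_on S F"
  unfolding fip_on_def using beta_Inter beta_empty beta_sub by (metis PowI subset_iff)

text \<open>Otherwise all complements lie in \<open>p\<close>, and their finite intersection misses
  the union.\<close>

lemma beta_UN:
  "finite H \<Longrightarrow> (\<Union>t\<in>H. A t) \<in> p \<Longrightarrow> \<exists>t\<in>H. A t \<in> p"
proof (rule ccontr)
  assume H: "finite H" "(\<Union>t\<in>H. A t) \<in> p" and "\<not> (\<exists>t\<in>H. A t \<in> p)"
  then have "(\<lambda>t. S - A t) ` H \<subseteq> p"
    using beta_Diff_iff beta_sub[OF H(2)] by blast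
  then have "S \<inter> \<Inter>((\<lambda>t. S - A t) ` H) \<in> p" using beta_Inter H(1) by blast
  from beta_Int[OF this H(2)] have "(S \<inter> \<Inter>((\<lambda>t. S - A t) ` H)) \<inter> (\<Union>t\<in>H. A t) \<in> p" .
  moreover have "(S \<inter> \<Inter>((\<lambda>t. S - A t) ` H)) \<inter> (\<Union>t\<in>H. A t) = {}" by blast
  ultimately show False using beta_empty by simp
qed

end

lemma beta_subset_eq:
  assumes "p \<in> beta S" and "q \<in> beta S" and "p \<subseteq> q"
  shows "p = q"
proof (rule ccontr)
  assume "p \<noteq> q"
  then obtain A where A: "A \<in> q" "A \<notin> p" using assms(3) by blast
  have "A \<subseteq> S" using beta_sub[OF assms(2) A(1)] .
  then have "S - A \<in> p" and "S - A \<notin> q" using beta_Diff_iff assms(1,2) A by auto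
  then show False using assms(3) by auto
qed

section \<open>The product as a semigroup with zero\<close>

locale psemigroup =
  fixes S :: "'a set" and f :: "'a \<Rightarrow> 'a \<Rightarrow> 'a option"
  assumes psg: "partial_semigroup S f"
begin

text \<open>For \<open>q = p\<close> this is the set in (b), and for \<open>A = S\<close> it is
  \<open>L(q)\<close>. Products then amount to composing the maps \<open>quot_in q\<close>.\<close>

definition quot_in :: "'a set set \<Rightarrow> 'a set \<Rightarrow> 'a set" where
  "quot_in q A = {s \<in> S. left_quot S f s A \<in> q}"

text \<open>For ultrafilters the value is \<open>{}\<close> exactly when the partial product is
  undefined, since \<open>quot_in q A\<close> grows with \<open>A\<close>.\<close>

definition mul :: "'a set set \<Rightarrow> 'a set set \<Rightarrow> 'a set set" (infixl "\<cdot>" 70) where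
  "p \<cdot> q = {A. A \<subseteq> S \<and> quot_in q A \<in> p}"

lemma mem_mul: "A \<in> p \<cdot> q \<longleftrightarrow> A \<subseteq> S \<and> quot_in q A \<in> p"
  unfolding mul_def by simp

lemma op_closed: "x \<in> S \<Longrightarrow> y \<in> S \<Longrightarrow> f x y = Some z \<Longrightarrow> z \<in> S"
  using psg unfolding partial_semigroup_def by blast

lemma left_quot_sub: "left_quot S f s A \<subseteq> Rset S f s" "Rset S f s \<subseteq> S"
  unfolding left_quot_def Rset_def by blast+

lemma left_quot_carrier:
  assumes "s \<in> S"
  shows "left_quot S f s S = Rset S f s"
proof -
  have "the (f s t) \<in> S" if "t \<in> S" "f s t \<noteq> None" for t
    using op_closed[OF assms that(1)] that(2) by auto
  then show ?thesis unfolding left_quot_def Rset_def by blast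
qed

lemma left_quot_Int: "left_quot S f s (A \<inter> B) = left_quot S f s A \<inter> left_quot S f s B"
  unfolding left_quot_def by blast

lemma left_quot_mono: "A \<subseteq> B \<Longrightarrow> left_quot S f s A \<subseteq> left_quot S f s B"
  unfolding left_quot_def by blast

text \<open>If \<open>f s t\<close> is undefined, strong associativity makes every
  \<open>s(tv)\<close> undefined as well, so the iterated quotient is empty.\<close>

lemma left_quot_left_quot:
  assumes "s \<in> S" and "t \<in> S"
  shows "left_quot S f t (left_quot S f s A) =
    (case f s t of None \<Rightarrow> {} | Some u \<Rightarrow> left_quot S f u A)"
proof -
  have as: "Option.bind (f s t) (\<lambda>u. f u v) = Option.bind (f t v) (\<lambda>u. f s u)" if "v \<in> S" for v
    using psg assms that unfolding partial_semigroup_def by blast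
  show ?thesis
  proof (cases "f s t")
    case None
    then have "f s w = None" if "v \<in> S" "f t v = Some w" for v w
      using as[OF that(1)] that(2) by simp
    then show ?thesis using None unfolding left_quot_def Rset_def by auto
  next
    case (Some u)
    have "v \<in> left_quot S f t (left_quot S f s A) \<longleftrightarrow> v \<in> left_quot S f u A" for v
    proof (cases "v \<in> S")
      case True
      then show ?thesis
        using as[OF True] Some op_closed[OF assms(2) True]
        unfolding left_quot_def Rset_def by (cases "f t v") auto
    next
      case False
      then show ?thesis unfolding left_quot_def Rset_def by simp
    qed
    then show ?thesis using Some by auto
  qed
qed

lemma quot_in_sub: "quot_in q A \<subseteq> S"
  unfolding quot_in_def by blast

text \<open>The condition \<open>{} \<notin> q\<close> excludes those \<open>t\<close> for which
  \<open>f s t\<close> is undefined: their iterated quotient is empty.\<close>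

lemma quot_in_left_quot:
  assumes "{} \<notin> q" and "s \<in> S"
  shows "quot_in q (left_quot S f s A) = left_quot S f s (quot_in q A)"
proof (rule set_eqI)
  fix t
  show "t \<in> quot_in q (left_quot S f s A) \<longleftrightarrow> t \<in> left_quot S f s (quot_in q A)"
  proof (cases "t \<in> S \<and> f s t \<noteq> None")
    case True
    then obtain u where u: "f s t = Some u" by blast
    then have "u \<in> S" using op_closed assms(2) True by blast
    then show ?thesis
      using left_quot_left_quot[OF assms(2), of t A] True u
      unfolding quot_in_def left_quot_def[of S f s "Collect _"] Rset_def by simp
  next
    case False
    then show ?thesis
      using left_quot_left_quot[OF assms(2), of t A] assms(1)
      unfolding quot_in_def left_quot_def[of S f s "Collect _"] Rset_def by auto
  qed
qed

lemma quot_in_mul: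
  assumes "{} \<notin> r"
  shows "quot_in (q \<cdot> r) A = quot_in q (quot_in r A)"
proof -
  have "left_quot S f s A \<in> q \<cdot> r \<longleftrightarrow> left_quot S f s (quot_in r A) \<in> q" if "s \<in> S" for s
    using quot_in_left_quot[OF assms that] left_quot_sub unfolding mul_def by fastforce
  then show ?thesis unfolding quot_in_def[of "q \<cdot> r"] quot_in_def[of q] by blast
qed

text \<open>Both sides unfold to \<open>quot_in q (quot_in r A) \<in> p\<close>. The law also covers
  intermediate products equal to \<open>{}\<close>, so no definedness has to be tracked.\<close>

lemma mul_assoc: "{} \<notin> r \<Longrightarrow> (p \<cdot> q) \<cdot> r = p \<cdot> (q \<cdot> r)"
  by (rule set_eqI) (simp add: mem_mul quot_in_mul quot_in_sub)

lemma empty_mul: "{} \<cdot> q = {}"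
  unfolding mul_def by blast

lemma mul_empty: "{} \<notin> p \<Longrightarrow> p \<cdot> {} = {}"
  unfolding mul_def quot_in_def by auto

lemma Lset_eq: "Lset S f q = quot_in q S"
  unfolding Lset_def quot_in_def using left_quot_carrier by auto

lemma quot_in_mono:
  assumes "q \<in> beta S" and "A \<subseteq> B"
  shows "quot_in q A \<subseteq> quot_in q B"
proof -
  have "left_quot S f s B \<in> q" if "left_quot S f s A \<in> q" for s
    using beta_up[OF assms(1) that left_quot_mono[OF assms(2)]] left_quot_sub by blast
  then show ?thesis unfolding quot_in_def by blast
qed

lemma quot_in_Int:
  assumes "q \<in> beta S"
  shows "quot_in q (A \<inter> B) = quot_in q A \<inter> quot_in q B"
proof
  show "quot_in q (A \<inter> B) \<subseteq> quot_in q A \<inter> quot_in q B"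
    using quot_in_mono[OF assms, of "A \<inter> B"] by blast
  show "quot_in q A \<inter> quot_in q B \<subseteq> quot_in q (A \<inter> B)"
    using beta_Int[OF assms] unfolding quot_in_def left_quot_Int by blast
qed

text \<open>The complement is relative to \<open>L(q)\<close>: when \<open>R(s) \<in> q\<close>,
  exactly one of the quotients of \<open>A\<close> and \<open>S - A\<close> by \<open>s\<close>
  belongs to \<open>q\<close>.\<close>

lemma quot_in_Diff:
  assumes "q \<in> beta S" and "A \<subseteq> S"
  shows "quot_in q (S - A) = quot_in q S - quot_in q A"
proof -
  have "quot_in q (S - A) \<inter> quot_in q A = quot_in q {}"
    using quot_in_Int[OF assms(1), of "S - A" A] by (simp add: Diff_disjoint inf_commute)
  also have "\<dots> = {}"
    using beta_empty[OF assms(1)] unfolding quot_in_def left_quot_def by simp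
  finally have disj: "quot_in q (S - A) \<inter> quot_in q A = {}" .
  have "s \<in> quot_in q (S - A)" if "s \<in> quot_in q S" "s \<notin> quot_in q A" for s
  proof -
    have s: "s \<in> S" "Rset S f s \<in> q" "left_quot S f s A \<notin> q"
      using that left_quot_carrier unfolding quot_in_def by auto
    then have "S - left_quot S f s A \<in> q"
      using beta_Diff_iff[OF assms(1)] left_quot_sub by (metis order_trans)
    then have "Rset S f s \<inter> (S - left_quot S f s A) \<in> q"
      using s beta_Int[OF assms(1)] by blast
    moreover have "Rset S f s \<inter> (S - left_quot S f s A) = left_quot S f s (S - A)"
      using left_quot_carrier[OF s(1)] unfolding left_quot_def Rset_def by auto
    ultimately show ?thesis using s(1) unfolding quot_in_def by simp
  qed
  then show ?thesis using disj quot_in_mono[OF assms(1), of "S - A" S] by blast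
qed

lemma mul_beta:
  assumes p: "p \<in> beta S" and q: "q \<in> beta S" and ne: "p \<cdot> q \<noteq> {}"
  shows "p \<cdot> q \<in> beta S"
proof -
  obtain A where "A \<subseteq> S" "quot_in q A \<in> p" using ne unfolding mul_def by blast
  then have S: "quot_in q S \<in> p"
    using beta_up[OF p _ quot_in_mono[OF q, of A S] quot_in_sub] by simp
  show ?thesis
    unfolding beta_def ultrafilter_on_def mem_Collect_eq mem_mul
  proof (intro conjI ballI allI impI)
    show "p \<cdot> q \<subseteq> Pow S" unfolding mul_def by blast
    show "S \<subseteq> S" "quot_in q S \<in> p" using S by auto
    have "quot_in q {} = {}"
      using beta_empty[OF q] unfolding quot_in_def left_quot_def by simp
    then show "\<not> ({} \<subseteq> S \<and> quot_in q {} \<in> p)" using beta_empty[OF p] by simp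
  next
    fix A B assume "A \<in> p \<cdot> q" "B \<in> p \<cdot> q"
    then show "A \<inter> B \<subseteq> S" "quot_in q (A \<inter> B) \<in> p"
      using quot_in_Int[OF q] beta_Int[OF p] unfolding mem_mul by auto
  next
    fix A B assume "A \<in> p \<cdot> q" "A \<subseteq> B \<and> B \<subseteq> S"
    then show "B \<subseteq> S" "quot_in q B \<in> p"
      using beta_up[OF p _ quot_in_mono[OF q, of A B] quot_in_sub] by (simp_all add: mem_mul)
  next
    fix A assume A: "A \<subseteq> S"
    have "quot_in q (S - A) \<in> p" if "quot_in q A \<notin> p"
    proof -
      have "S - quot_in q A \<in> p" using that beta_Diff_iff[OF p] quot_in_sub by blast
      then have "quot_in q S \<inter> (S - quot_in q A) \<in> p" using beta_Int[OF p S] by blast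
      moreover have "quot_in q S \<inter> (S - quot_in q A) = quot_in q S - quot_in q A"
        using quot_in_sub by blast
      ultimately show ?thesis using quot_in_Diff[OF q A] by simp
    qed
    then show "A \<subseteq> S \<and> quot_in q A \<in> p \<or> S - A \<subseteq> S \<and> quot_in q (S - A) \<in> p"
      using A by blast
  qed
qed

lemma mul_nonempty_iff:
  assumes "p \<in> beta S" and "q \<in> beta S"
  shows "p \<cdot> q \<noteq> {} \<longleftrightarrow> quot_in q S \<in> p"
  using mul_beta[OF assms] beta_carrier[of "p \<cdot> q" S] mem_mul[of S p q] by blast

lemma beta_mult_eq_Some:
  assumes "p \<in> beta S" and "q \<in> beta S"
  shows "beta_mult S f p q = Some r \<longleftrightarrow> r = p \<cdot> q \<and> r \<noteq> {}"
  using mul_nonempty_iff[OF assms]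
  unfolding beta_mult_def Lset_eq mul_def quot_in_def[of q] by auto

text \<open>An undefined \<open>r \<cdot> q\<close> drops out by itself, since then
  \<open>r \<cdot> q \<cdot> p = {}\<close>, which is not \<open>p\<close>.\<close>

lemma set_mult_set_mult:
  assumes "q \<in> beta S" and "p \<in> beta S"
  shows "p \<in> set_mult (beta_mult S f) (set_mult (beta_mult S f) (beta S) {q}) {p} \<longleftrightarrow>
    (\<exists>r\<in>beta S. r \<cdot> q \<cdot> p = p)"
proof -
  have ne: "p \<noteq> {}" using beta_carrier[OF assms(2)] by blast
  have 1: "set_mult (beta_mult S f) (beta S) {q} = {r \<cdot> q |r. r \<in> beta S \<and> r \<cdot> q \<noteq> {}}"
    unfolding set_mult_def by (auto simp: beta_mult_eq_Some[OF _ assms(1)])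
  have "beta_mult S f (r \<cdot> q) p = Some p \<longleftrightarrow> r \<cdot> q \<cdot> p = p" if "r \<in> beta S" "r \<cdot> q \<noteq> {}" for r
    using beta_mult_eq_Some[OF mul_beta[OF that(1) assms(1) that(2)] assms(2)] ne by metis
  then show ?thesis unfolding 1 unfolding set_mult_def using empty_mul ne by fastforce
qed

section \<open>The subsemigroup \<open>\<delta>\<^sub>R S\<close>\<close>

lemma delta_R_iff: "p \<in> delta_R S f \<longleftrightarrow> p \<in> beta S \<and> (\<forall>s\<in>S. Rset S f s \<in> p)"
proof
  assume p: "p \<in> delta_R S f"
  obtain s where "s \<in> S" using psg unfolding partial_semigroup_def by blast
  have "p \<in> beta_cl S (Rfin S f {s})" if "s \<in> S" for s
    using p that unfolding delta_R_def by blast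
  then show "p \<in> beta S \<and> (\<forall>s\<in>S. Rset S f s \<in> p)"
    using \<open>s \<in> S\<close> unfolding beta_cl_def Rfin_def by auto
next
  assume p: "p \<in> beta S \<and> (\<forall>s\<in>S. Rset S f s \<in> p)"
  have "Rfin S f H \<in> p" if "finite H" "H \<noteq> {}" "H \<subseteq> S" for H
  proof -
    have "S \<inter> \<Inter>(Rset S f ` H) \<in> p" using beta_Inter[of p S "Rset S f ` H"] p that by blast
    moreover have "S \<inter> \<Inter>(Rset S f ` H) = Rfin S f H"
      using that left_quot_sub(2) unfolding Rfin_def by blast
    ultimately show ?thesis by simp
  qed
  then show "p \<in> delta_R S f" using p unfolding delta_R_def beta_cl_def by blast
qed

lemma quot_in_delta: "p \<in> delta_R S f \<Longrightarrow> quot_in p S = S"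
  unfolding delta_R_iff quot_in_def using left_quot_carrier by auto

lemma mul_delta_beta: "u \<in> beta S \<Longrightarrow> p \<in> delta_R S f \<Longrightarrow> u \<cdot> p \<in> beta S"
  using mul_beta mul_nonempty_iff quot_in_delta beta_carrier delta_R_iff by metis

lemma Rset_mem_mul:
  assumes "v \<in> beta S" and "s \<in> S"
  shows "Rset S f s \<in> u \<cdot> v \<longleftrightarrow> left_quot S f s (quot_in v S) \<in> u"
  using quot_in_left_quot[OF beta_empty[OF assms(1)] assms(2), of S] left_quot_carrier[OF assms(2)]
    left_quot_sub(2) unfolding mem_mul by auto

text \<open>Since \<open>L(v) = S\<close>, the quotient of \<open>L(v)\<close> by \<open>s\<close>
  is \<open>R(s)\<close>, which lies in \<open>u\<close>.\<close>

lemma mul_delta: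
  assumes "u \<in> delta_R S f" and "v \<in> delta_R S f"
  shows "u \<cdot> v \<in> delta_R S f"
  using assms mul_delta_beta[of u v] Rset_mem_mul[of v _ u] quot_in_delta[of v] left_quot_carrier
  unfolding delta_R_iff[of u] delta_R_iff[of "u \<cdot> v"] by (metis delta_R_iff)

text \<open>\<open>R(s) \<in> u \<cdot> y\<close> says that the quotient of \<open>L(y)\<close> by
  \<open>s\<close> lies in \<open>u\<close>, and this quotient is contained in
  \<open>R(s)\<close>.\<close>

lemma delta_mulD:
  assumes "u \<in> beta S" and "y \<in> beta S" and "u \<cdot> y \<in> delta_R S f"
  shows "u \<in> delta_R S f"
  unfolding delta_R_iff
proof (intro conjI ballI)
  show "u \<in> beta S" by (rule assms(1))
  fix s assume s: "s \<in> S"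
  then have "left_quot S f s (quot_in y S) \<in> u"
    using Rset_mem_mul[OF assms(2)] assms(3) delta_R_iff by simp
  then show "Rset S f s \<in> u" by (rule beta_up[OF assms(1) _ left_quot_sub])
qed

section \<open>Minimal closed left ideals of \<open>\<delta>\<^sub>R S\<close>\<close>

text \<open>A closed subset of \<open>\<beta>S\<close> is encoded by a family \<open>F\<close>, as the set of all \<open>p\<close> with \<open>F \<subseteq> p\<close>, so
  that compactness of \<open>\<beta>S\<close> becomes the fact that unions of chains of families with the finite
  intersection property again have it.\<close>

lemma minimal_left_ideal:
  assumes "delta_R S f \<noteq> {}"
  obtains M where "M \<noteq> {}" and "M \<subseteq> delta_R S f"
    and "\<And>u m. u \<in> delta_R S f \<Longrightarrow> m \<in> M \<Longrightarrow> u \<cdot> m \<in> M"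
    and "\<And>m n. m \<in> M \<Longrightarrow> n \<in> M \<Longrightarrow> \<exists>z\<in>delta_R S f. n = z \<cdot> m"
proof -
  define cl where "cl F = {p \<in> beta S. F \<subseteq> p}" for F
  \<comment> \<open>Larger families encode smaller closed sets, so a maximal family encodes a
    minimal closed left ideal; containing all \<open>R(s)\<close> keeps \<open>cl F\<close> inside
    \<open>delta_R S f\<close>.\<close>
  define \<A> where "\<A> = {F. fip_on S F \<and> Rset S f ` S \<subseteq> F \<and>
    (\<forall>u\<in>delta_R S f. \<forall>m\<in>cl F. u \<cdot> m \<in> cl F)}"
  obtain d where d: "d \<in> delta_R S f" using assms by blast
  have clR: "cl (Rset S f ` S) = delta_R S f" unfolding cl_def using delta_R_iff by auto
  have "fip_on S (Rset S f ` S)" using fip_on_subset_beta[of d S] d unfolding delta_R_iff by blast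
  then have base: "Rset S f ` S \<in> \<A>" unfolding \<A>_def using clR mul_delta by blast
  have "\<exists>F\<in>\<A>. \<forall>G\<in>\<A>. F \<subseteq> G \<longrightarrow> G = F"
  proof (rule subset_Zorn)
    fix C assume C: "subset.chain \<A> C"
    show "\<exists>U\<in>\<A>. \<forall>X\<in>C. X \<subseteq> U"
    proof (cases "C = {}")
      case True
      then show ?thesis using base by blast
    next
      case False
      have CA: "C \<subseteq> \<A>" using C unfolding subset.chain_def by blast
      then have "fip_on S (\<Union>C)"
        using fip_on_Union_chain[OF _ C False] unfolding \<A>_def by blast
      moreover have "Rset S f ` S \<subseteq> \<Union>C" using CA False unfolding \<A>_def by blast
      moreover have "u \<cdot> m \<in> cl (\<Union>C)" if "u \<in> delta_R S f" "m \<in> cl (\<Union>C)" for u m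
      proof -
        have clC: "cl (\<Union>C) = (\<Inter>F\<in>C. cl F)" using False unfolding cl_def by blast
        have "u \<cdot> m \<in> cl F" if "F \<in> C" for F
        proof -
          have "F \<in> \<A>" and "m \<in> cl F" using CA that \<open>m \<in> cl (\<Union>C)\<close> clC by auto
          then show ?thesis using \<open>u \<in> delta_R S f\<close> unfolding \<A>_def by simp
        qed
        then show ?thesis using clC by simp
      qed
      ultimately have "\<Union>C \<in> \<A>" unfolding \<A>_def by simp
      then show ?thesis by blast
    qed
  qed
  then obtain F where "F \<in> \<A>" and max: "\<forall>G\<in>\<A>. F \<subseteq> G \<longrightarrow> G = F" ..
  then have F: "fip_on S F" "Rset S f ` S \<subseteq> F"
    and ideal: "\<And>u m. u \<in> delta_R S f \<Longrightarrow> m \<in> cl F \<Longrightarrow> u \<cdot> m \<in> cl F"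
    unfolding \<A>_def by simp_all
  have sub: "cl F \<subseteq> delta_R S f" using F(2) unfolding clR[symmetric] cl_def by auto
  have "\<exists>z\<in>delta_R S f. n = z \<cdot> m" if m: "m \<in> cl F" and n: "n \<in> cl F" for m n
  proof -
    have mb: "m \<in> beta S" using m unfolding cl_def by auto
    have md: "m \<in> delta_R S f" using sub m by blast
    \<comment> \<open>\<open>G\<close> is the family encoding the closure of
      \<open>delta_R S f \<cdot> m\<close>; \<open>attained\<close> shows that this set is already
      closed.\<close>
    define G where "G = {A. \<forall>w\<in>delta_R S f. A \<in> w \<cdot> m}"
    have attained: "\<exists>w\<in>delta_R S f. v = w \<cdot> m" if v: "v \<in> beta S" "G \<subseteq> v" for v
    proof -
      \<comment> \<open>An ultrafilter containing this family lies in \<open>delta_R S f\<close> and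
        solves \<open>v = w \<cdot> m\<close>.\<close>
      have "fip_on S (Rset S f ` S \<union> quot_in m ` v)"
        unfolding fip_on_def
      proof (intro conjI allI impI)
        show "Rset S f ` S \<union> quot_in m ` v \<subseteq> Pow S" using left_quot_sub(2) quot_in_sub by blast
        fix X assume X: "finite X \<and> X \<subseteq> Rset S f ` S \<union> quot_in m ` v"
        then obtain Y where Y: "Y \<subseteq> v" "finite Y" "X \<inter> quot_in m ` v = quot_in m ` Y"
          using finite_subset_image[of "X \<inter> quot_in m ` v" "quot_in m" v] by auto
        define A where "A = S \<inter> \<Inter>Y"
        have A: "A \<in> v" unfolding A_def using beta_Inter[OF v(1) Y(2,1)] .
        then have AS: "A \<subseteq> S" using beta_sub[OF v(1)] by blast
        \<comment> \<open>As \<open>A \<in> v\<close> and \<open>G \<subseteq> v\<close>, some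
          \<open>w \<cdot> m\<close> contains \<open>A\<close>; this \<open>w\<close> contains all
          of \<open>X\<close>.\<close>
        have "S - A \<notin> G" using v A beta_Diff_iff[OF v(1) AS] by blast
        then obtain w where w: "w \<in> delta_R S f" "S - A \<notin> w \<cdot> m" unfolding G_def by blast
        then have wb: "w \<in> beta S" unfolding delta_R_iff by blast
        have "A \<in> w \<cdot> m"
          using w(2) beta_Diff_iff[OF mul_delta_beta[OF wb md] AS] by blast
        then have "quot_in m A \<in> w" unfolding mem_mul by blast
        then have "quot_in m B \<in> w" if "B \<in> Y" for B
          using beta_up[OF wb] quot_in_mono[OF mb, of A B] quot_in_sub that unfolding A_def by blast
        then have "quot_in m ` Y \<subseteq> w" by auto
        moreover have "Rset S f ` S \<subseteq> w" using w(1) delta_R_iff by auto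
        moreover have "X \<subseteq> Rset S f ` S \<union> quot_in m ` Y" using X Y(3) by blast
        ultimately have "X \<subseteq> w" by (meson Un_least subset_trans)
        then have "S \<inter> \<Inter>X \<in> w" using beta_Inter[OF wb] X by blast
        then show "S \<inter> \<Inter>X \<noteq> {}" using beta_empty[OF wb] by metis
      qed
      then obtain w where w: "w \<in> beta S" "Rset S f ` S \<union> quot_in m ` v \<subseteq> w"
        using fip_on_extends_to_ultrafilter by blast
      then have "v \<subseteq> w \<cdot> m" using beta_sub[OF v(1)] unfolding mul_def by blast
      then have "v = w \<cdot> m" using beta_subset_eq[OF v(1) mul_delta_beta[OF w(1) md]] by blast
      moreover have "w \<in> delta_R S f" using w delta_R_iff by auto
      ultimately show ?thesis by auto
    qed
    have clG: "cl G = (\<lambda>w. w \<cdot> m) ` delta_R S f"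
    proof
      show "cl G \<subseteq> (\<lambda>w. w \<cdot> m) ` delta_R S f" using attained unfolding cl_def by auto
      show "(\<lambda>w. w \<cdot> m) ` delta_R S f \<subseteq> cl G"
        using mul_delta_beta[OF _ md] delta_R_iff unfolding cl_def G_def by auto
    qed
    have "G \<in> \<A>"
      unfolding \<A>_def mem_Collect_eq
    proof (intro conjI ballI)
      have "G \<subseteq> d \<cdot> m" using d unfolding G_def by blast
      then show "fip_on S G"
        using fip_on_subset_beta[OF mul_delta_beta[OF _ md]] d unfolding delta_R_iff by blast
      show "Rset S f ` S \<subseteq> G"
        using mul_delta[OF _ md] delta_R_iff unfolding G_def by auto
      fix u k assume u: "u \<in> delta_R S f" and "k \<in> cl G"
      then obtain w where w: "w \<in> delta_R S f" "k = w \<cdot> m" using clG by blast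
      then have "u \<cdot> k = (u \<cdot> w) \<cdot> m" using mul_assoc[OF beta_empty[OF mb]] by metis
      then show "u \<cdot> k \<in> cl G" using clG mul_delta[OF u w(1)] by blast
    qed
    \<comment> \<open>\<open>delta_R S f \<cdot> m\<close> lies inside \<open>cl F\<close>, so
      maximality of \<open>F\<close> makes the two sets equal.\<close>
    moreover have "F \<subseteq> G" using ideal[OF _ m] unfolding cl_def G_def by blast
    ultimately have "G = F" using max by blast
    then show ?thesis using n clG by blast
  qed
  moreover have "cl F \<noteq> {}"
    using fip_on_extends_to_ultrafilter[OF F(1)] unfolding cl_def by blast
  ultimately show thesis using that sub ideal by blast
qed

section \<open>Membership in the smallest ideal\<close>

text \<open>The defined products obtained from \<open>M\<close> by multiplying on the left, then on
  the right, form an ideal \<open>I\<close>, and the smallest ideal lies inside it.\<close>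

lemma smallest_ideal_generated:
  assumes p: "p \<in> smallest_ideal (beta S) (beta_mult S f)" and M: "M \<subseteq> beta S" "M \<noteq> {}"
  obtains m where "m \<in> M \<or> (\<exists>x\<in>beta S. \<exists>m'\<in>M. m = x \<cdot> m')" and "m \<in> beta S"
    and "p = m \<or> (\<exists>y\<in>beta S. p = m \<cdot> y)"
proof -
  define N where "N = M \<union> {x \<cdot> m |x m. x \<in> beta S \<and> m \<in> M \<and> x \<cdot> m \<noteq> {}}"
  define I where "I = N \<union> {m \<cdot> y |m y. m \<in> N \<and> y \<in> beta S \<and> m \<cdot> y \<noteq> {}}"
  have Nb: "N \<subseteq> beta S" unfolding N_def using M(1) mul_beta by blast
  then have Ib: "I \<subseteq> beta S" unfolding I_def using mul_beta by blast
  have assoc: "a \<cdot> b \<cdot> c = a \<cdot> (b \<cdot> c)" if "c \<in> beta S" for a b c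
    using mul_assoc[OF beta_empty[OF that]] .
  have mulN: "x \<cdot> n \<in> N" if x: "x \<in> beta S" and n: "n \<in> N" and xn: "x \<cdot> n \<noteq> {}" for x n
  proof (cases "n \<in> M")
    case True
    then show ?thesis using x xn unfolding N_def by blast
  next
    case False
    then obtain y m where ym: "n = y \<cdot> m" "y \<in> beta S" "m \<in> M"
      using n unfolding N_def by blast
    have eq: "x \<cdot> n = (x \<cdot> y) \<cdot> m" using assoc[of m x y] ym M(1) by auto
    \<comment> \<open>A zero left factor would make the whole product zero.\<close>
    then have "x \<cdot> y \<noteq> {}" using xn empty_mul by metis
    then have "x \<cdot> y \<in> beta S" using mul_beta x ym(2) by blast
    then show ?thesis using eq ym(3) xn unfolding N_def by blast
  qed
  have "two_sided_ideal (beta S) (beta_mult S f) I"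
    unfolding two_sided_ideal_def
  proof (intro conjI ballI allI impI)
    show "I \<noteq> {}" using M(2) unfolding I_def N_def by blast
    show "I \<subseteq> beta S" by (rule Ib)
  next
    fix i x k assume i: "i \<in> I" and x: "x \<in> beta S" and "beta_mult S f x i = Some k"
    then have k: "k = x \<cdot> i" "x \<cdot> i \<noteq> {}" using beta_mult_eq_Some[of x i k] Ib by blast+
    show "k \<in> I"
    proof (cases "i \<in> N")
      case True
      then show ?thesis using mulN k x unfolding I_def by blast
    next
      case False
      then obtain n y where ny: "i = n \<cdot> y" "n \<in> N" "y \<in> beta S"
        using i unfolding I_def by blast
      have eq: "k = (x \<cdot> n) \<cdot> y" using k(1) ny assoc by simp
      then have "x \<cdot> n \<in> N" using mulN x ny(2) k empty_mul by metis
      then show ?thesis using eq ny(3) k unfolding I_def by blast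
    qed
  next
    fix i x k assume i: "i \<in> I" and x: "x \<in> beta S" and "beta_mult S f i x = Some k"
    then have k: "k = i \<cdot> x" "i \<cdot> x \<noteq> {}" using beta_mult_eq_Some[of i x k] Ib by blast+
    show "k \<in> I"
    proof (cases "i \<in> N")
      case True
      then show ?thesis using k x unfolding I_def by blast
    next
      case False
      then obtain n y where ny: "i = n \<cdot> y" "n \<in> N" "y \<in> beta S"
        using i unfolding I_def by blast
      have eq: "k = n \<cdot> (y \<cdot> x)" using k(1) ny assoc x by simp
      have "{} \<notin> n" using beta_empty ny(2) Nb by blast
      then have "y \<cdot> x \<noteq> {}" using eq k mul_empty by metis
      then have "y \<cdot> x \<in> beta S" using mul_beta ny(3) x by blast
      then show ?thesis using eq ny(2) k unfolding I_def by blast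
    qed
  qed
  then have "p \<in> I" using p unfolding smallest_ideal_def by blast
  then obtain m where "m \<in> N" "p = m \<or> (\<exists>y\<in>beta S. p = m \<cdot> y)" unfolding I_def by blast
  then show thesis using that Nb unfolding N_def by blast
qed

lemma smallest_ideal_imp_factor:
  assumes pd: "p \<in> delta_R S f" and pK: "p \<in> smallest_ideal (beta S) (beta_mult S f)"
    and q: "q \<in> beta S"
  shows "\<exists>r\<in>beta S. r \<cdot> q \<cdot> p = p"
proof -
  have db: "delta_R S f \<subseteq> beta S" using delta_R_iff by blast
  have assoc: "a \<cdot> b \<cdot> c = a \<cdot> (b \<cdot> c)" if "c \<in> beta S" for a b c
    using mul_assoc[OF beta_empty[OF that]] .
  have "\<exists>x\<in>beta S. x \<cdot> q \<in> delta_R S f"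
  proof -
    obtain m where m: "m = q \<or> (\<exists>x\<in>beta S. m = x \<cdot> q)" "m \<in> beta S"
      "p = m \<or> (\<exists>y\<in>beta S. p = m \<cdot> y)"
      using smallest_ideal_generated[OF pK, of "{q}"] q by auto
    then have "m \<in> delta_R S f" using delta_mulD pd by blast
    \<comment> \<open>If \<open>m = q\<close>, then \<open>p\<close> itself serves as the left
      factor.\<close>
    then show ?thesis using m(1) mul_delta[OF pd] pd db by blast
  qed
  then obtain x where x: "x \<in> beta S" "x \<cdot> q \<in> delta_R S f" by blast
  obtain M where M: "M \<noteq> {}" "M \<subseteq> delta_R S f"
    and Mideal: "\<And>u m. u \<in> delta_R S f \<Longrightarrow> m \<in> M \<Longrightarrow> u \<cdot> m \<in> M"
    and Mmin: "\<And>m n. m \<in> M \<Longrightarrow> n \<in> M \<Longrightarrow> \<exists>z\<in>delta_R S f. n = z \<cdot> m"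
    using minimal_left_ideal pd by blast
  obtain m where m: "m \<in> M \<or> (\<exists>y\<in>beta S. \<exists>m'\<in>M. m = y \<cdot> m')" "m \<in> beta S"
      "p = m \<or> (\<exists>y\<in>beta S. p = m \<cdot> y)"
    using smallest_ideal_generated[OF pK _ M(1)] M(2) db by blast
  then have "m \<in> delta_R S f" using delta_mulD pd by blast
  \<comment> \<open>If \<open>m = y \<cdot> m'\<close>, then \<open>delta_mulD\<close> puts
    \<open>y\<close> into \<open>delta_R S f\<close>, and \<open>M\<close> is a left ideal
    there.\<close>
  then have mM: "m \<in> M" using m(1) Mideal delta_mulD M(2) db by blast
  then obtain z where z: "z \<in> delta_R S f" "m = z \<cdot> ((x \<cdot> q) \<cdot> m)"
    using Mmin[OF Mideal[OF x(2) mM] mM] by blast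
  define r where "r = z \<cdot> x"
  have "m = z \<cdot> (x \<cdot> q) \<cdot> m" using z(2) assoc[OF m(2)] by simp
  then have rm: "m = r \<cdot> q \<cdot> m" unfolding r_def using assoc[OF q] by simp
  have "m \<noteq> {}" using beta_carrier[OF m(2)] by blast
  then have "r \<noteq> {}" using rm empty_mul by metis
  then have "r \<in> beta S" unfolding r_def using mul_beta z(1) x(1) db by blast
  \<comment> \<open>The identity for \<open>m\<close> carries over to \<open>p = m \<cdot> y\<close>
    by multiplying by \<open>y\<close> on the right.\<close>
  moreover have "r \<cdot> q \<cdot> p = p"
    using m(3) rm assoc by metis
  ultimately show ?thesis by blast
qed

text \<open>Any ideal contains some \<open>q\<close>, hence \<open>r \<cdot> q\<close>, hence
  \<open>r \<cdot> q \<cdot> p = p\<close>.\<close>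

lemma factor_imp_smallest_ideal:
  assumes pd: "p \<in> delta_R S f" and c: "\<And>q. q \<in> beta S \<Longrightarrow> \<exists>r\<in>beta S. r \<cdot> q \<cdot> p = p"
  shows "p \<in> smallest_ideal (beta S) (beta_mult S f)"
  unfolding smallest_ideal_def
proof (rule InterI)
  fix I assume "I \<in> {I. two_sided_ideal (beta S) (beta_mult S f) I}"
  then have Ine: "I \<noteq> {}" and Isub: "I \<subseteq> beta S"
    and I: "\<And>x y z. x \<in> I \<Longrightarrow> y \<in> beta S \<Longrightarrow>
      (beta_mult S f y x = Some z \<longrightarrow> z \<in> I) \<and> (beta_mult S f x y = Some z \<longrightarrow> z \<in> I)"
    unfolding two_sided_ideal_def by blast+
  have pb: "p \<in> beta S" using pd delta_R_iff by blast
  then have pne: "p \<noteq> {}" using beta_carrier by blast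
  obtain q where q: "q \<in> I" "q \<in> beta S" using Ine Isub by blast
  then obtain r where r: "r \<in> beta S" "r \<cdot> q \<cdot> p = p" using c by blast
  have "r \<cdot> q \<noteq> {}" using r(2) pne empty_mul by metis
  then have rq: "r \<cdot> q \<in> I" using I[OF q(1) r(1)] beta_mult_eq_Some[OF r(1) q(2)] by blast
  then show "p \<in> I"
    using I[OF rq pb] beta_mult_eq_Some[of "r \<cdot> q" p p] Isub pb r(2) pne by auto
qed

section \<open>Partial syndeticity and the factorization condition\<close>

lemma syndetic_imp_factor:
  assumes pd: "p \<in> delta_R S f" and b: "\<And>A. A \<in> p \<Longrightarrow> partially_syndetic S f (quot_in p A)"
    and q: "q \<in> beta S"
  shows "\<exists>r\<in>beta S. r \<cdot> q \<cdot> p = p"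
proof -
  have pb: "p \<in> beta S" using pd delta_R_iff by blast
  have ne: "quot_in q (quot_in p A) \<noteq> {}" if A: "A \<in> p" for A
  proof -
    obtain H where H: "finite H" "H \<noteq> {}" "H \<subseteq> Lset S f q"
      "Rfin S f H \<subseteq> (\<Union>t\<in>H. left_quot S f t (quot_in p A))"
      using bspec[OF b[OF A, unfolded partially_syndetic_def] q] by auto
    have "Rset S f ` H \<subseteq> q" using H(3) unfolding Lset_def by blast
    then have "S \<inter> \<Inter>(Rset S f ` H) \<in> q" using beta_Inter[OF q] H(1) by blast
    \<comment> \<open>\<open>R(H)\<close> lies in \<open>q\<close> because
      \<open>H \<subseteq> L(q)\<close>, so one of the finitely many quotients covering it lies in
      \<open>q\<close>.\<close>
    then have "(\<Union>t\<in>H. left_quot S f t (quot_in p A)) \<in> q"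
      using beta_up[OF q] H(4) left_quot_sub unfolding Rfin_def by (meson UN_least inf_le2 order_trans)
    then obtain t where "t \<in> H" "left_quot S f t (quot_in p A) \<in> q"
      using beta_UN[OF q H(1)] by blast
    then show ?thesis using H(3) unfolding quot_in_def[of q] Lset_def by blast
  qed
  have "fip_on S ((\<lambda>A. quot_in q (quot_in p A)) ` p)"
    unfolding fip_on_def
  proof (intro conjI allI impI)
    show "(\<lambda>A. quot_in q (quot_in p A)) ` p \<subseteq> Pow S" using quot_in_sub by blast
    fix X assume "finite X \<and> X \<subseteq> (\<lambda>A. quot_in q (quot_in p A)) ` p"
    then obtain Y where Y: "Y \<subseteq> p" "finite Y" "X = (\<lambda>A. quot_in q (quot_in p A)) ` Y"
      using finite_subset_image by metis
    \<comment> \<open>By monotonicity, nonemptiness for the single set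
      \<open>S \<inter> \<Inter>Y \<in> p\<close> handles the whole finite subfamily.\<close>
    have "quot_in q (quot_in p (S \<inter> \<Inter>Y)) \<subseteq> S \<inter> \<Inter>X"
    proof -
      have "quot_in q (quot_in p (S \<inter> \<Inter>Y)) \<subseteq> quot_in q (quot_in p B)" if "B \<in> Y" for B
        using quot_in_mono[OF q quot_in_mono[OF pb]] that by blast
      then show ?thesis using Y(3) quot_in_sub by blast
    qed
    then show "S \<inter> \<Inter>X \<noteq> {}" using ne[OF beta_Inter[OF pb Y(2,1)]] by blast
  qed
  then obtain r where r: "r \<in> beta S" "(\<lambda>A. quot_in q (quot_in p A)) ` p \<subseteq> r"
    using fip_on_extends_to_ultrafilter by blast
  have sub: "p \<subseteq> r \<cdot> q \<cdot> p"
    using r(2) beta_sub[OF pb] quot_in_sub unfolding mul_def by blast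
  then have "r \<cdot> q \<noteq> {}" using beta_carrier[OF pb] empty_mul by force
  then have "r \<cdot> q \<cdot> p \<in> beta S" using mul_delta_beta[OF mul_beta[OF r(1) q] pd] by blast
  then show ?thesis using beta_subset_eq[OF pb _ sub] r(1) by metis
qed

lemma factor_imp_syndetic:
  assumes pd: "p \<in> delta_R S f" and c: "\<And>q. q \<in> beta S \<Longrightarrow> \<exists>r\<in>beta S. r \<cdot> q \<cdot> p = p"
    and A: "A \<in> p"
  shows "partially_syndetic S f (quot_in p A)"
  unfolding partially_syndetic_def
proof (rule ballI, rule ccontr)
  define B where "B = quot_in p A"
  have pb: "p \<in> beta S" using pd delta_R_iff by blast
  then have pne: "p \<noteq> {}" using beta_carrier by blast
  fix r assume r: "r \<in> beta S"
  assume "\<not> (\<exists>H. finite H \<and> H \<noteq> {} \<and> H \<subseteq> Lset S f r \<and>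
        Rfin S f H \<subseteq> (\<Union>t\<in>H. left_quot S f t (quot_in p A)))"
  then have bad: "\<not> Rfin S f H \<subseteq> (\<Union>t\<in>H. left_quot S f t B)"
    if "finite H" "H \<noteq> {}" "H \<subseteq> quot_in r S" for H
    using that unfolding B_def Lset_eq by blast
  obtain w where w: "w \<in> beta S" "w \<cdot> r \<cdot> p = p" using c[OF r] by blast
  have wr: "w \<cdot> r \<in> beta S" using w(2) pne empty_mul mul_beta[OF w(1) r] by metis
  then have Lw: "quot_in r S \<in> w" using beta_carrier[OF wr] unfolding mem_mul by blast
  have "w \<cdot> r \<in> delta_R S f" using delta_mulD[OF wr pb] w(2) pd by simp
  \<comment> \<open>This does not depend on a left factor: it makes
    \<open>quot_in w (quot_in r S)\<close> all of \<open>S\<close>, so \<open>L(r)\<close> belongs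
    to \<open>z \<cdot> w\<close> for every ultrafilter \<open>z\<close>.\<close>
  then have sw: "left_quot S f s (quot_in r S) \<in> w" if "s \<in> S" for s
    using Rset_mem_mul[OF r that] that unfolding delta_R_iff by blast
  \<comment> \<open>Failure of syndeticity at \<open>r\<close> is exactly what makes finite
    intersections nonempty.\<close>
  have "fip_on S ((\<lambda>t. Rset S f t - left_quot S f t B) ` quot_in r S)"
    unfolding fip_on_def
  proof (intro conjI allI impI)
    show "(\<lambda>t. Rset S f t - left_quot S f t B) ` quot_in r S \<subseteq> Pow S"
      using left_quot_sub(2) by blast
    fix X assume "finite X \<and> X \<subseteq> (\<lambda>t. Rset S f t - left_quot S f t B) ` quot_in r S"
    then obtain H where H: "H \<subseteq> quot_in r S" "finite H"
      "X = (\<lambda>t. Rset S f t - left_quot S f t B) ` H"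
      using finite_subset_image[of X "\<lambda>t. Rset S f t - left_quot S f t B" "quot_in r S"] by auto
    show "S \<inter> \<Inter>X \<noteq> {}"
    proof (cases "H = {}")
      case True
      then show ?thesis using H(3) psg unfolding partial_semigroup_def by simp
    next
      case False
      then obtain u where "u \<in> Rfin S f H" "u \<notin> (\<Union>t\<in>H. left_quot S f t B)"
        using bad H by blast
      then show ?thesis using H(3) False left_quot_sub(2) unfolding Rfin_def by blast
    qed
  qed
  then obtain q where q: "q \<in> beta S"
    "(\<lambda>t. Rset S f t - left_quot S f t B) ` quot_in r S \<subseteq> q"
    using fip_on_extends_to_ultrafilter by blast
  \<comment> \<open>This makes \<open>w \<cdot> q\<close> defined, so the hypothesis applies to
    it.\<close>
  have "quot_in r S \<subseteq> quot_in q S"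
  proof
    fix t assume t: "t \<in> quot_in r S"
    then have "t \<in> S" "Rset S f t - left_quot S f t B \<in> q" using q(2) quot_in_sub by blast+
    then have "Rset S f t \<in> q" using beta_up[OF q(1)] left_quot_sub(2) by blast
    then show "t \<in> quot_in q S" using \<open>t \<in> S\<close> left_quot_carrier unfolding quot_in_def by simp
  qed
  then have "quot_in q S \<in> w" using beta_up[OF w(1) Lw] quot_in_sub by blast
  then have "w \<cdot> q \<in> beta S" using mul_beta[OF w(1) q(1)] mul_nonempty_iff[OF w(1) q(1)] by blast
  then obtain z where z: "z \<in> beta S" "z \<cdot> (w \<cdot> q) \<cdot> p = p" using c by blast
  then have zwq: "z \<cdot> w \<cdot> q \<cdot> p = p" using mul_assoc[OF beta_empty[OF q(1)]] by simp
  then have zw: "z \<cdot> w \<in> beta S" using mul_beta[OF z(1) w(1)] pne empty_mul by metis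
  have "quot_in w (quot_in r S) = S" using sw unfolding quot_in_def[of w] by blast
  then have L: "quot_in r S \<in> z \<cdot> w" using beta_carrier[OF z(1)] quot_in_sub unfolding mem_mul by simp
  have "B \<in> z \<cdot> w \<cdot> q" using A zwq unfolding B_def using mem_mul[of A "z \<cdot> w \<cdot> q" p] by simp
  then have "quot_in q B \<in> z \<cdot> w" unfolding mem_mul[of B] by blast
  \<comment> \<open>A common element \<open>t\<close> lies in \<open>L(r)\<close> while its quotient
    of \<open>B\<close> lies in \<open>q\<close>, contrary to the choice of
    \<open>q\<close>.\<close>
  then have "quot_in q B \<inter> quot_in r S \<noteq> {}" using beta_Int[OF zw _ L] beta_empty[OF zw] by metis
  then obtain t where "t \<in> quot_in r S" "left_quot S f t B \<in> q" unfolding quot_in_def[of q] by blast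
  then have "(Rset S f t - left_quot S f t B) \<inter> left_quot S f t B \<in> q"
    using q(2) beta_Int[OF q(1)] by blast
  then show False using beta_empty[OF q(1)] by (simp add: Int_commute)
qed

end

theorem theorem2p22:
  fixes S :: "'a set" and f :: "'a \<Rightarrow> 'a \<Rightarrow> 'a option" and p :: "'a set set"
  assumes "partial_semigroup S f"
    and "right_adequate S f"
    and "p \<in> delta_R S f"
  shows
    "(p \<in> smallest_ideal (beta S) (beta_mult S f) \<longleftrightarrow>
        (\<forall>A\<in>p. partially_syndetic S f {s \<in> S. left_quot S f s A \<in> p})) \<and>
     ((\<forall>A\<in>p. partially_syndetic S f {s \<in> S. left_quot S f s A \<in> p}) \<longleftrightarrow>
        (\<forall>q\<in>beta_cl S (Lset S f p).
           p \<in> set_mult (beta_mult S f) (set_mult (beta_mult S f) (beta S) {q}) {p}))"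
proof -
  interpret psemigroup S f by unfold_locales (rule assms(1))
  have p: "p \<in> beta S" using assms(3) delta_R_iff by blast
  \<comment> \<open>For \<open>p\<close> in \<open>delta_R S f\<close>, \<open>L(p) = S\<close>, so
    (c) ranges over all of \<open>\<beta>S\<close>.\<close>
  have "beta_cl S (Lset S f p) = beta S"
    using quot_in_delta[OF assms(3)] beta_carrier unfolding beta_cl_def Lset_eq by auto
  then have c: "(\<forall>q\<in>beta_cl S (Lset S f p).
      p \<in> set_mult (beta_mult S f) (set_mult (beta_mult S f) (beta S) {q}) {p}) \<longleftrightarrow>
      (\<forall>q\<in>beta S. \<exists>r\<in>beta S. r \<cdot> q \<cdot> p = p)"
    using set_mult_set_mult[OF _ p] by simp
  show ?thesis
    unfolding c quot_in_def[symmetric]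
    using smallest_ideal_imp_factor[OF assms(3)] factor_imp_smallest_ideal[OF assms(3)]
      syndetic_imp_factor[OF assms(3)] factor_imp_syndetic[OF assms(3)] by blast
qed

end
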